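(* For every $S\subseteq V$ and every $v\in V\setminus S$, the reduction in squared normalized target risk from adding $v$ to $S$ is $$r_\beta(S;g_{\tau,c})^2-r_\beta(S\cup\{v\};g_{\tau,c})^2=A_v(S)\,\eta_v(S),$$ where $$A_v(S):=\frac{\beta\,\|q_v(S)\|_2^2}{\|g_{\tau,c}\|_2^2},\qquad \eta_v(S):=\frac{q_v(S)^T\left(I+G_v(S)\right)^{-1}q_v(S)}{\|q_v(S)\|_2^2}\ \text{ if } q_v(S)\neq 0,\qquad \eta_v(S):=0\ \text{ if } q_v(S)=0.$$ In all cases, $0\le\eta_v(S)\le 1$.
   Context: Let $G=(V,E,\omega)$ be a finite, undirected, connected graph with $n=|V|$ vertices and edge weights $\omega_{uv}>0$ for $\{u,v\}\in E$. Let $W$ be the weighted adjacency matrix ($W_{uv}=\omega_{uv}$ if $\{u,v\}\in E$, and $0$ otherwise), $D$ the diagonal matrix of weighted degrees $D_{vv}=\sum_u W_{uv}$, and $L=D-W$ the unnormalized weighted Laplacian. Fix an orthogonal eigendecomposition $L=U\Lambda U^T$, with orthonormal eigenvector columns $\phi_0,\ldots,\phi_{n-1}$ of $U$ and eigenvalues $0=\lambda_0<\lambda_1\le\cdots\le\lambda_{n-1}$; $\phi_\ell(v)$ is the entry of $\phi_\ell$ at vertex $v$. Fix a retained bandwidth $K$ with $1\le K\le n$, and set $U_K=[\phi_0\ \cdots\ \phi_{K-1}]$, $\Lambda_K=\operatorname{diag}(\lambda_0,\ldots,\lambda_{K-1})$. Fix a prediction horizon $\tau>0$ and observation times $0\le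 t_1<\cdots<t_r<\tau$. For a vertex $v$, the measurement block is the matrix $R_v\in\mathbb{R}^{r\times K}$ with entries $R_v(j,\ell)=e^{-t_j\lambda_\ell}\phi_\ell(v)$, $j=1,\ldots,r$, $\ell=0,\ldots,K-1$. For $S=\{v_1,\ldots,v_m\}\subseteq V$, $B_S\in\mathbb{R}^{rm\times K}$ is the matrix obtained by stacking $R_{v_1},\ldots,R_{v_m}$ vertically (for $S=\varnothing$ it has no rows). Let $c\in\mathbb{R}^n$ with $c\ge 0$ entrywise and $\mathbf{1}^Tc=1$, and let $g_{\tau,c}:=e^{-\tau\Lambda_K}U_K^Tc\in\mathbb{R}^K$ be the target direction. Fix $\beta>0$. The regularized target risk is $$J_\beta(S):=\min_{w\in\mathbb{R}^{r|S|}}\left\{\|B_S^Tw-g_{\tau,c}\|_2^2+\beta\|w\|_2^2\right\},$$ and the normalized target risk $r_\beta(S;g_{\tau,c})\ge 0$ is defined by $r_\beta(S;g_{\tau,c})^2:=J_\beta(S)/\|g_{\tau,c}\|_2^2$. Define also $$C_S:=\beta I+\sum_{u\in S}R_u^TR_u,\quad h_S:=C_S^{-1}g_{\tau,c},\quad q_v(S):=R_vh_S,\quad G_v(S):=R_vC_S^{-1}R_v^T.$$ *)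

theory Defs
  imports Complex_Main "Jordan_Normal_Form.Matrix" "Jordan_Normal_Form.Gauss_Jordan_Elimination"
begin

text \<open>
  Rows and columns of matrices are numbered from 0.  A list \<open>vs\<close> that enumerates the vertex set
  without repetition fixes the numbering of the vertices used by all matrices.  An edge is a
  two-element set of vertices, so symmetry of the weights is built in.
\<close>

definition connected_on :: "'a set \<Rightarrow> 'a set set \<Rightarrow> bool" where
  "connected_on V E \<longleftrightarrow> (\<forall>u\<in>V. \<forall>v\<in>V. (u, v) \<in> {(x, y). {x, y} \<in> E}\<^sup>*)"

definition weighted_graph :: "'a set \<Rightarrow> 'a set set \<Rightarrow> ('a set \<Rightarrow> real) \<Rightarrow> bool" where
  "weighted_graph V E \<omega> \<longleftrightarrow>
     finite V \<and> (\<forall>e\<in>E. e \<subseteq> V \<and> card e = 2) \<and> (\<forall>e\<in>E. 0 < \<omega> e)"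

definition adjacency_mat :: "'a list \<Rightarrow> 'a set set \<Rightarrow> ('a set \<Rightarrow> real) \<Rightarrow> real mat" where
  "adjacency_mat vs E \<omega> = mat (length vs) (length vs)
     (\<lambda>(i, j). if {vs ! i, vs ! j} \<in> E then \<omega> {vs ! i, vs ! j} else 0)"

definition degree_mat :: "real mat \<Rightarrow> real mat" where
  "degree_mat W = mat_diag (dim_row W) (\<lambda>j. \<Sum>i<dim_row W. W $$ (i, j))"

definition laplacian_mat :: "'a list \<Rightarrow> 'a set set \<Rightarrow> ('a set \<Rightarrow> real) \<Rightarrow> real mat" where
  "laplacian_mat vs E \<omega> = degree_mat (adjacency_mat vs E \<omega>) - adjacency_mat vs E \<omega>"

definition vertex_index :: "'a list \<Rightarrow> 'a \<Rightarrow> nat" where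
  "vertex_index vs v = (THE i. i < length vs \<and> vs ! i = v)"

text \<open>The observation time \<open>t\<^sub>j\<close> is \<open>ts ! (j - 1)\<close>, and \<open>\<phi>\<^sub>l\<close> is column \<open>l\<close> of \<open>U\<close>.\<close>

definition measurement_block ::
  "'a list \<Rightarrow> real mat \<Rightarrow> (nat \<Rightarrow> real) \<Rightarrow> real list \<Rightarrow> nat \<Rightarrow> 'a \<Rightarrow> real mat" where
  "measurement_block vs U lam ts K v = mat (length ts) K
     (\<lambda>(j, l). exp (- (ts ! j) * lam l) * U $$ (vertex_index vs v, l))"

text \<open>The exponential of the diagonal matrix \<open>- \<tau> \<Lambda>\<^sub>K\<close> is written out entrywise.\<close>

definition target_direction ::
  "real mat \<Rightarrow> (nat \<Rightarrow> real) \<Rightarrow> nat \<Rightarrow> real \<Rightarrow> real vec \<Rightarrow> real vec" where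
  "target_direction U lam K \<tau> c =
     mat_diag K (\<lambda>l. exp (- \<tau> * lam l)) *\<^sub>v
       ((mat_of_cols (dim_row U) (map (col U) [0..<K]))\<^sup>T *\<^sub>v c)"

definition l2norm :: "real vec \<Rightarrow> real" where
  "l2norm x = sqrt (x \<bullet> x)"

text \<open>
  In the following definitions \<open>R v\<close> stands for the \<open>r \<times> K\<close> block of the vertex \<open>v\<close>.  The blocks of
  \<open>S\<close> are stacked in the order in which the vertices occur in \<open>vs\<close>.
\<close>

definition stacked_mat :: "'a list \<Rightarrow> nat \<Rightarrow> nat \<Rightarrow> ('a \<Rightarrow> real mat) \<Rightarrow> 'a set \<Rightarrow> real mat" where
  "stacked_mat vs r K R S = mat (r * card S) K
     (\<lambda>(i, l). R (filter (\<lambda>v. v \<in> S) vs ! (i div r)) $$ (i mod r, l))"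

text \<open>
  The minimum is \<open>LEAST\<close>, not an infimum: using its value requires a proof that it is attained.
\<close>

definition target_risk ::
  "'a list \<Rightarrow> nat \<Rightarrow> nat \<Rightarrow> ('a \<Rightarrow> real mat) \<Rightarrow> real \<Rightarrow> real vec \<Rightarrow> 'a set \<Rightarrow> real" where
  "target_risk vs r K R \<beta> g S =
     (LEAST x. x \<in> (\<lambda>w. (l2norm ((stacked_mat vs r K R S)\<^sup>T *\<^sub>v w - g))\<^sup>2 + \<beta> * (l2norm w)\<^sup>2)
                  ` carrier_vec (r * card S))"

definition normalized_target_risk ::
  "'a list \<Rightarrow> nat \<Rightarrow> nat \<Rightarrow> ('a \<Rightarrow> real mat) \<Rightarrow> real \<Rightarrow> real vec \<Rightarrow> 'a set \<Rightarrow> real" where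
  "normalized_target_risk vs r K R \<beta> g S = sqrt (target_risk vs r K R \<beta> g S / (l2norm g)\<^sup>2)"

text \<open>Only meaningful for invertible \<open>A\<close>; \<open>mat_inverse\<close> returns \<open>None\<close> otherwise.\<close>

definition inv_mat :: "real mat \<Rightarrow> real mat" where
  "inv_mat A = the (mat_inverse A)"

text \<open>
  The sum of matrices is taken entrywise, because \<open>mat\<close> is not an additive monoid as a type.
\<close>

definition C_mat :: "nat \<Rightarrow> ('a \<Rightarrow> real mat) \<Rightarrow> real \<Rightarrow> 'a set \<Rightarrow> real mat" where
  "C_mat K R \<beta> S = \<beta> \<cdot>\<^sub>m 1\<^sub>m K + mat K K (\<lambda>(i, j). \<Sum>u\<in>S. ((R u)\<^sup>T * R u) $$ (i, j))"

definition h_vec :: "nat \<Rightarrow> ('a \<Rightarrow> real mat) \<Rightarrow> real \<Rightarrow> real vec \<Rightarrow> 'a set \<Rightarrow> real vec" where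
  "h_vec K R \<beta> g S = inv_mat (C_mat K R \<beta> S) *\<^sub>v g"

definition q_vec :: "nat \<Rightarrow> ('a \<Rightarrow> real mat) \<Rightarrow> real \<Rightarrow> real vec \<Rightarrow> 'a set \<Rightarrow> 'a \<Rightarrow> real vec" where
  "q_vec K R \<beta> g S v = R v *\<^sub>v h_vec K R \<beta> g S"

definition G_mat :: "nat \<Rightarrow> ('a \<Rightarrow> real mat) \<Rightarrow> real \<Rightarrow> 'a set \<Rightarrow> 'a \<Rightarrow> real mat" where
  "G_mat K R \<beta> S v = R v * inv_mat (C_mat K R \<beta> S) * (R v)\<^sup>T"

definition A_factor :: "nat \<Rightarrow> ('a \<Rightarrow> real mat) \<Rightarrow> real \<Rightarrow> real vec \<Rightarrow> 'a set \<Rightarrow> 'a \<Rightarrow> real" where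
  "A_factor K R \<beta> g S v = \<beta> * (l2norm (q_vec K R \<beta> g S v))\<^sup>2 / (l2norm g)\<^sup>2"

definition eta_factor ::
  "nat \<Rightarrow> nat \<Rightarrow> ('a \<Rightarrow> real mat) \<Rightarrow> real \<Rightarrow> real vec \<Rightarrow> 'a set \<Rightarrow> 'a \<Rightarrow> real" where
  "eta_factor r K R \<beta> g S v =
     (let q = q_vec K R \<beta> g S v in
      if q = 0\<^sub>v r then 0
      else (q \<bullet> (inv_mat (1\<^sub>m r + G_mat K R \<beta> S v) *\<^sub>v q)) / (l2norm q)\<^sup>2)"

end

theory Submission
  imports Defs "Jordan_Normal_Form.Determinant"
begin

text \<open>
  With \<open>B\<close> the stacked matrix, \<open>C\<^sub>S = \<beta>I + B\<^sup>TB\<close>, and completing the square around \<open>w = Bh\<^sub>S\<close> gives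
  \<open>J\<^sub>\<beta>(S) = \<beta> g \<bullet> h\<^sub>S\<close>.  Adding \<open>v\<close> turns \<open>C\<^sub>S\<close> into \<open>C\<^sub>S + R\<^sub>v\<^sup>TR\<^sub>v\<close>; if \<open>x\<close> solves \<open>(I + G\<^sub>v)x = q\<^sub>v\<close>,
  then the new \<open>h\<close> is \<open>h\<^sub>S - C\<^sub>S\<^sup>-\<^sup>1R\<^sub>v\<^sup>Tx\<close> (Woodbury's identity), so that the risk drops by
  \<open>\<beta> q\<^sub>v \<bullet> x\<close>.  Finally, \<open>0 \<le> q\<^sub>v \<bullet> x \<le> q\<^sub>v \<bullet> q\<^sub>v\<close> because \<open>G\<^sub>v\<close> is positive semidefinite.
\<close>

section \<open>Positivity of the scalar product and invertibility of coercive matrices\<close>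

lemma scalar_prod_self_nonneg: "0 \<le> x \<bullet> (x :: real vec)"
  by (simp add: scalar_prod_def sum_nonneg)

lemma scalar_prod_self_pos:
  fixes x :: "real vec"
  assumes "x \<in> carrier_vec n" "x \<noteq> 0\<^sub>v n"
  shows "0 < x \<bullet> x"
proof -
  obtain i where i: "i < n" "x $ i \<noteq> 0"
    using assms by (metis carrier_vecD eq_vecI index_zero_vec)
  have "0 < x $ i * x $ i"
    using i by (simp add: zero_less_mult_iff) linarith
  also have "\<dots> \<le> (\<Sum>j\<in>{0..<n}. x $ j * x $ j)"
    using i by (intro member_le_sum) auto
  finally show ?thesis
    using assms by (simp add: scalar_prod_def)
qed

lemma l2norm_square: "(l2norm x)\<^sup>2 = x \<bullet> x"
  by (simp add: l2norm_def scalar_prod_self_nonneg)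

text \<open>For a unit of the matrix ring, \<open>mat_inverse\<close> cannot return
  \<open>None\<close>, so the \<open>the\<close> in \<open>inv_mat\<close> yields a genuine
  two-sided inverse.\<close>

lemma inv_mat_unit:
  assumes "A \<in> Units (ring_mat TYPE(real) n ())" "A \<in> carrier_mat n n"
  shows "inv_mat A \<in> carrier_mat n n" "A * inv_mat A = 1\<^sub>m n" "inv_mat A * A = 1\<^sub>m n"
proof -
  obtain B where "mat_inverse A = Some B"
    using mat_inverse(1)[OF assms(2), of "()"] assms(1) by fastforce
  then show "inv_mat A \<in> carrier_mat n n" "A * inv_mat A = 1\<^sub>m n" "inv_mat A * A = 1\<^sub>m n"
    using mat_inverse(2)[OF assms(2)] by (auto simp: inv_mat_def)
qed

text \<open>Coercivity forces a trivial kernel, hence a nonzero determinant. It is applied with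
  \<open>a = \<beta>\<close> to \<open>C_mat\<close> and with \<open>a = 1\<close> to
  \<open>1\<^sub>m r + G_mat\<close>.\<close>

lemma coercive_imp_unit:
  fixes A :: "real mat"
  assumes A: "A \<in> carrier_mat n n" and "0 < a"
    and coercive: "\<And>x. x \<in> carrier_vec n \<Longrightarrow> a * (x \<bullet> x) \<le> x \<bullet> (A *\<^sub>v x)"
  shows "A \<in> Units (ring_mat TYPE(real) n ())"
proof -
  have "A *\<^sub>v x \<noteq> 0\<^sub>v n" if x: "x \<in> carrier_vec n" "x \<noteq> 0\<^sub>v n" for x
  proof
    assume "A *\<^sub>v x = 0\<^sub>v n"
    then have "a * (x \<bullet> x) \<le> 0"
      using coercive[OF x(1)] x by simp
    then show False
      using scalar_prod_self_pos[OF x] \<open>0 < a\<close> by (simp add: mult_le_0_iff)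
  qed
  then have "det A \<noteq> 0"
    using det_0_iff_vec_prod_zero[OF A] by blast
  then show ?thesis
    by (rule det_non_zero_imp_unit[OF A])
qed

section \<open>Regularized least squares for a single matrix \<open>B\<close>\<close>

context
  fixes B :: "real mat" and \<beta> :: real and m K :: nat
  assumes B: "B \<in> carrier_mat m K" and \<beta>: "0 < \<beta>"
begin

lemma ridge_mult_vec:
  assumes "x \<in> carrier_vec K"
  shows "(\<beta> \<cdot>\<^sub>m 1\<^sub>m K + B\<^sup>T * B) *\<^sub>v x = \<beta> \<cdot>\<^sub>v x + B\<^sup>T *\<^sub>v (B *\<^sub>v x)"
proof -
  have "(\<beta> \<cdot>\<^sub>m 1\<^sub>m K) *\<^sub>v x = \<beta> \<cdot>\<^sub>v x"
    using assms by (intro eq_vecI) (auto simp: smult_scalar_prod_distrib[of _ K])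
  then show ?thesis
    using assms B
    by (subst add_mult_distrib_mat_vec[of _ K K]) (auto simp: assoc_mult_mat_vec[of _ K m _ K])
qed

text \<open>Moving \<open>B\<^sup>T\<close> to the other side of the scalar product shows the form
  to be symmetric, and for \<open>x = y\<close> at least \<open>\<beta> * (x \<bullet> x)\<close>.
  Both facts are later read off for \<open>C_mat\<close>.\<close>

lemma ridge_bilinear:
  assumes x: "x \<in> carrier_vec K" and y: "y \<in> carrier_vec K"
  shows "x \<bullet> ((\<beta> \<cdot>\<^sub>m 1\<^sub>m K + B\<^sup>T * B) *\<^sub>v y) = \<beta> * (x \<bullet> y) + (B *\<^sub>v x) \<bullet> (B *\<^sub>v y)"
proof -
  have By: "B *\<^sub>v y \<in> carrier_vec m" using B y by simp
  have BBy: "B\<^sup>T *\<^sub>v (B *\<^sub>v y) \<in> carrier_vec K" using B by (intro carrier_vecI) auto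
  have "x \<bullet> (B\<^sup>T *\<^sub>v (B *\<^sub>v y)) = (B\<^sup>T *\<^sub>v (B *\<^sub>v y)) \<bullet> x"
    using comm_scalar_prod[OF x BBy] .
  also have "\<dots> = (B *\<^sub>v y) \<bullet> (B *\<^sub>v x)"
    by (rule transpose_vec_mult_scalar[OF B x By])
  also have "\<dots> = (B *\<^sub>v x) \<bullet> (B *\<^sub>v y)"
    using B x y by (intro comm_scalar_prod[of _ m]) auto
  finally show ?thesis
    using x y BBy by (simp add: ridge_mult_vec scalar_prod_add_distrib[of _ K])
qed

text \<open>The unknown \<open>w\<close> has \<open>m\<close> entries, but the normal equation is
  posed in dimension \<open>K\<close>; the minimizer is recovered as
  \<open>p = B *\<^sub>v h\<close>. Around \<open>p\<close> the objective is a constant plus a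
  nonnegative quadratic form in \<open>w - p\<close>, so the minimum is attained there, as
  \<open>LEAST\<close> demands.\<close>

lemma ridge_minimum:
  assumes h: "h \<in> carrier_vec K" and normal: "(\<beta> \<cdot>\<^sub>m 1\<^sub>m K + B\<^sup>T * B) *\<^sub>v h = g"
  shows "(LEAST x. x \<in> (\<lambda>w. (l2norm (B\<^sup>T *\<^sub>v w - g))\<^sup>2 + \<beta> * (l2norm w)\<^sup>2) ` carrier_vec m)
      = \<beta> * (g \<bullet> h)"
proof -
  define F where "F w = (l2norm (B\<^sup>T *\<^sub>v w - g))\<^sup>2 + \<beta> * (l2norm w)\<^sup>2" for w
  define p where "p = B *\<^sub>v h"
  have p: "p \<in> carrier_vec m" using B h by (simp add: p_def)
  \<comment> \<open>Thus the residual at \<open>p\<close> is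
    \<open>- \<beta> \<cdot>\<^sub>v h\<close>.\<close>
  have g_eq: "g = \<beta> \<cdot>\<^sub>v h + B\<^sup>T *\<^sub>v p"
    using normal ridge_mult_vec[OF h] by (simp add: p_def)
  then have g: "g \<in> carrier_vec K" using h p B by auto
  have gh: "g \<bullet> h = \<beta> * (h \<bullet> h) + p \<bullet> p"
    using ridge_bilinear[OF h h] normal comm_scalar_prod[OF g h] by (simp add: p_def)
  have F_eq: "F w = \<beta> * (g \<bullet> h) + ((B\<^sup>T *\<^sub>v (w - p)) \<bullet> (B\<^sup>T *\<^sub>v (w - p)) + \<beta> * ((w - p) \<bullet> (w - p)))"
    if w: "w \<in> carrier_vec m" for w
  proof -
    define d where "d = w - p"
    define e where "e = B\<^sup>T *\<^sub>v d"
    have d: "d \<in> carrier_vec m" using w p by (simp add: d_def)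
    have e: "e \<in> carrier_vec K" unfolding e_def using B by (intro carrier_vecI) auto
    have w_eq: "w = p + d" using w p by (auto simp: d_def)
    have "B\<^sup>T *\<^sub>v w = B\<^sup>T *\<^sub>v p + e"
      unfolding w_eq e_def using B by (intro mult_add_distrib_mat_vec[OF _ p d]) auto
    then have resid: "B\<^sup>T *\<^sub>v w - g = e - \<beta> \<cdot>\<^sub>v h"
      unfolding g_eq using B h e by (intro eq_vecI) auto
    \<comment> \<open>This makes the cross terms cancel:
      \<open>- 2 * \<beta> * (e \<bullet> h)\<close> from the residual against
      \<open>2 * \<beta> * (d \<bullet> p)\<close> from the penalty. By \<open>gh\<close>, the terms
      free of \<open>d\<close> and \<open>e\<close> add up to
      \<open>\<beta> * (g \<bullet> h)\<close>.\<close>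
    have eh: "e \<bullet> h = d \<bullet> p"
      unfolding e_def p_def by (rule transpose_vec_mult_scalar[OF B h d])
    have "(e - \<beta> \<cdot>\<^sub>v h) \<bullet> (e - \<beta> \<cdot>\<^sub>v h) = e \<bullet> e - 2 * \<beta> * (e \<bullet> h) + \<beta> * \<beta> * (h \<bullet> h)"
      using e h comm_scalar_prod[OF e h]
      by (simp add: minus_scalar_prod_distrib[of _ K] scalar_prod_minus_distrib[of _ K]
          algebra_simps)
    moreover have "w \<bullet> w = p \<bullet> p + 2 * (d \<bullet> p) + d \<bullet> d"
      using p d comm_scalar_prod[OF p d]
      by (simp add: w_eq add_scalar_prod_distrib[of _ m] scalar_prod_add_distrib[of _ m])
    ultimately show ?thesis
      by (simp add: F_def l2norm_square resid eh gh flip: d_def e_def) (simp add: algebra_simps)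
  qed
  have B_zero: "B\<^sup>T *\<^sub>v 0\<^sub>v m = 0\<^sub>v K" using B by (intro eq_vecI) auto
  have "F p = \<beta> * (g \<bullet> h)"
    using F_eq[OF p] p B_zero by (simp add: minus_cancel_vec)
  moreover have "\<beta> * (g \<bullet> h) \<le> F w" if "w \<in> carrier_vec m" for w
    using \<beta> by (simp add: F_eq[OF that] scalar_prod_self_nonneg)
  ultimately show ?thesis
    unfolding F_def[symmetric] using p by (intro Least_equality) (auto intro!: image_eqI[of _ F p])
qed

end

text \<open>An entry of the Gram matrix is a sum over all stacked rows. Writing the row number as
  \<open>b + a * r\<close> with \<open>b < r\<close> splits it into one inner sum per block; the
  blocks are then reindexed from positions in the filtered list to vertices of
  \<open>S\<close>.\<close>

lemma stacked_mat_gram: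
  assumes vs: "distinct vs" "S \<subseteq> set vs" and R: "\<And>u. R u \<in> carrier_mat r K"
  shows "(stacked_mat vs r K R S)\<^sup>T * stacked_mat vs r K R S
      = mat K K (\<lambda>(i, j). \<Sum>u\<in>S. ((R u)\<^sup>T * R u) $$ (i, j))"
proof (rule eq_matI, goal_cases)
  case (1 i j)
  define xs where "xs = filter (\<lambda>v. v \<in> S) vs"
  have xs: "distinct xs" "set xs = S" using vs by (auto simp: xs_def)
  then have len: "length xs = card S" using distinct_card by fastforce
  from 1 have i: "i < K" and j: "j < K" by auto
  define f where "f k = R (xs ! (k div r)) $$ (k mod r, i) * R (xs ! (k div r)) $$ (k mod r, j)" for k
  have "((stacked_mat vs r K R S)\<^sup>T * stacked_mat vs r K R S) $$ (i, j) = (\<Sum>k<card S * r. f k)"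
    using i j
    by (simp add: stacked_mat_def scalar_prod_def f_def flip: xs_def)
      (simp add: lessThan_atLeast0 mult.commute)
  also have "\<dots> = (\<Sum>a<card S. \<Sum>k\<in>{a * r..<a * r + r}. f k)"
    by (rule sum.nat_group[symmetric])
  also have "\<dots> = (\<Sum>a<card S. ((R (xs ! a))\<^sup>T * R (xs ! a)) $$ (i, j))"
  proof (rule sum.cong[OF refl])
    fix a
    have "(\<Sum>k\<in>{a * r..<a * r + r}. f k) = (\<Sum>b\<in>{0..<r}. f (b + a * r))"
      using sum.shift_bounds_nat_ivl[of f 0 "a * r" r] by (simp add: add.commute)
    also have "\<dots> = ((R (xs ! a))\<^sup>T * R (xs ! a)) $$ (i, j)"
      using i j R[of "xs ! a"] by (auto simp: f_def scalar_prod_def intro!: sum.cong)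
    finally show "(\<Sum>k\<in>{a * r..<a * r + r}. f k) = ((R (xs ! a))\<^sup>T * R (xs ! a)) $$ (i, j)" .
  qed
  also have "\<dots> = (\<Sum>u\<in>S. ((R u)\<^sup>T * R u) $$ (i, j))"
    \<comment> \<open>Since \<open>xs\<close> lists \<open>S\<close> without repetition, positions
      and vertices correspond bijectively.\<close>
    using xs len bij_betw_nth[OF xs(1) refl xs(2)[symmetric]]
    by (intro sum.reindex_bij_betw) (simp add: lessThan_atLeast0)
  finally show ?case using i j by simp
qed (auto simp: stacked_mat_def)

section \<open>The matrices \<open>C_mat\<close> and the closed form of the risk\<close>

context
  fixes vs :: "'a list" and r K :: nat and R :: "'a \<Rightarrow> real mat" and \<beta> :: real
  assumes vs: "distinct vs" and R: "\<And>u. R u \<in> carrier_mat r K" and \<beta>: "0 < \<beta>"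
begin

lemma C_mat_ridge:
  assumes "S \<subseteq> set vs"
  shows "C_mat K R \<beta> S = \<beta> \<cdot>\<^sub>m 1\<^sub>m K + (stacked_mat vs r K R S)\<^sup>T * stacked_mat vs r K R S"
  using stacked_mat_gram[of vs S R r K] vs assms R by (simp add: C_mat_def)

lemma stacked_mat_carrier: "stacked_mat vs r K R S \<in> carrier_mat (r * card S) K"
  by (simp add: stacked_mat_def)

lemma C_mat_carrier: "C_mat K R \<beta> S \<in> carrier_mat K K"
  by (simp add: C_mat_def)

text \<open>The Gram part contributes a squared norm, which is dropped. This bound is the source of
  the invertibility of \<open>C_mat\<close>, of the nonnegativity of the risk and of the
  semidefiniteness of \<open>G_mat\<close>.\<close>

lemma C_mat_coercive:
  assumes "S \<subseteq> set vs" "x \<in> carrier_vec K"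
  shows "\<beta> * (x \<bullet> x) \<le> x \<bullet> (C_mat K R \<beta> S *\<^sub>v x)"
  using assms ridge_bilinear[OF stacked_mat_carrier \<beta>, of x x S]
  by (simp add: C_mat_ridge scalar_prod_self_nonneg)

lemma C_mat_symmetric:
  assumes "S \<subseteq> set vs" and x: "x \<in> carrier_vec K" and y: "y \<in> carrier_vec K"
  shows "x \<bullet> (C_mat K R \<beta> S *\<^sub>v y) = y \<bullet> (C_mat K R \<beta> S *\<^sub>v x)"
proof -
  let ?B = "stacked_mat vs r K R S"
  have "(?B *\<^sub>v x) \<bullet> (?B *\<^sub>v y) = (?B *\<^sub>v y) \<bullet> (?B *\<^sub>v x)"
    using stacked_mat_carrier[of S] x y by (intro comm_scalar_prod[of _ "r * card S"]) auto
  then show ?thesis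
    using ridge_bilinear[OF stacked_mat_carrier \<beta>] x y comm_scalar_prod[OF x y]
    by (simp add: C_mat_ridge[OF assms(1)])
qed

lemma C_mat_inverse:
  assumes "S \<subseteq> set vs"
  shows "inv_mat (C_mat K R \<beta> S) \<in> carrier_mat K K"
    and "C_mat K R \<beta> S * inv_mat (C_mat K R \<beta> S) = 1\<^sub>m K"
    and "inv_mat (C_mat K R \<beta> S) * C_mat K R \<beta> S = 1\<^sub>m K"
  using inv_mat_unit[OF coercive_imp_unit[OF C_mat_carrier \<beta> C_mat_coercive[OF assms]]]
    C_mat_carrier by auto

lemma C_mat_mult_inverse:
  assumes S: "S \<subseteq> set vs" and y: "y \<in> carrier_vec K"
  shows "C_mat K R \<beta> S *\<^sub>v (inv_mat (C_mat K R \<beta> S) *\<^sub>v y) = y"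
  using assoc_mult_mat_vec[OF C_mat_carrier C_mat_inverse(1)[OF S] y, of S] C_mat_inverse(2)[OF S] y
  by simp

lemma C_mat_inverse_mult:
  assumes S: "S \<subseteq> set vs" and y: "y \<in> carrier_vec K"
  shows "inv_mat (C_mat K R \<beta> S) *\<^sub>v (C_mat K R \<beta> S *\<^sub>v y) = y"
  using assoc_mult_mat_vec[OF C_mat_inverse(1)[OF S] C_mat_carrier y, of S] C_mat_inverse(3)[OF S] y
  by simp

text \<open>As \<open>v\<close> is new, the sum over vertices gains exactly the term
  \<open>(R v)\<^sup>T * R v\<close>. The form with a vector lets a candidate for the new
  \<open>h_vec\<close> be tested by substitution.\<close>

lemma C_mat_insert_mult:
  assumes "finite S" "v \<notin> S" and y: "y \<in> carrier_vec K"
  shows "C_mat K R \<beta> (insert v S) *\<^sub>v y = C_mat K R \<beta> S *\<^sub>v y + (R v)\<^sup>T *\<^sub>v (R v *\<^sub>v y)"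
proof -
  have Rv: "(R v)\<^sup>T \<in> carrier_mat K r" "(R v)\<^sup>T * R v \<in> carrier_mat K K"
    using R[of v] by auto
  have "C_mat K R \<beta> (insert v S) = C_mat K R \<beta> S + (R v)\<^sup>T * R v"
    using assms R[of v] by (intro eq_matI) (auto simp: C_mat_def)
  then show ?thesis
    using add_mult_distrib_mat_vec[OF C_mat_carrier Rv(2) y] assoc_mult_mat_vec[OF Rv(1) R y]
    by simp
qed

lemma h_vec_carrier:
  assumes "S \<subseteq> set vs" "g \<in> carrier_vec K"
  shows "h_vec K R \<beta> g S \<in> carrier_vec K"
  using C_mat_inverse(1)[OF assms(1)] assms(2) by (auto simp: h_vec_def)

text \<open>\<open>h_vec\<close> solves the normal equation of the stacked matrix. All later
  statements about the risk rest on this closed form instead of \<open>LEAST\<close>.\<close>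

lemma target_risk_eq:
  assumes "S \<subseteq> set vs" "g \<in> carrier_vec K"
  shows "target_risk vs r K R \<beta> g S = \<beta> * (g \<bullet> h_vec K R \<beta> g S)"
  unfolding target_risk_def
  using C_mat_mult_inverse[OF assms]
  by (intro ridge_minimum[OF stacked_mat_carrier \<beta> h_vec_carrier[OF assms]])
    (simp add: h_vec_def flip: C_mat_ridge[OF assms(1)])

text \<open>With \<open>g\<close> written as \<open>C_mat\<close> applied to \<open>h_vec\<close>,
  this is coercivity. It lets squaring undo the \<open>sqrt\<close> in
  \<open>normalized_target_risk\<close>.\<close>

lemma target_risk_nonneg:
  assumes S: "S \<subseteq> set vs" and g: "g \<in> carrier_vec K"
  shows "0 \<le> target_risk vs r K R \<beta> g S"
proof -
  let ?h = "h_vec K R \<beta> g S"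
  have h: "?h \<in> carrier_vec K" by (rule h_vec_carrier[OF S g])
  have "0 \<le> \<beta> * (?h \<bullet> ?h)" using \<beta> by (simp add: scalar_prod_self_nonneg)
  also have "\<dots> \<le> ?h \<bullet> (C_mat K R \<beta> S *\<^sub>v ?h)" by (rule C_mat_coercive[OF S h])
  also have "\<dots> = g \<bullet> ?h"
    using C_mat_mult_inverse[OF S g] comm_scalar_prod[OF h g] by (simp add: h_vec_def)
  finally show ?thesis using \<beta> by (simp add: target_risk_eq[OF S g])
qed

lemma normalized_target_risk_square:
  assumes "S \<subseteq> set vs" "g \<in> carrier_vec K"
  shows "(normalized_target_risk vs r K R \<beta> g S)\<^sup>2 = target_risk vs r K R \<beta> g S / (l2norm g)\<^sup>2"
  using target_risk_nonneg[OF assms] by (simp add: normalized_target_risk_def)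

section \<open>The matrices \<open>G_mat\<close> and the system for \<open>x\<close>\<close>

lemma G_mat_carrier:
  assumes "S \<subseteq> set vs"
  shows "G_mat K R \<beta> S v \<in> carrier_mat r r"
  using R[of v] C_mat_inverse(1)[OF assms] by (auto simp: G_mat_def)

lemma G_mat_mult:
  assumes S: "S \<subseteq> set vs" and x: "x \<in> carrier_vec r"
  shows "G_mat K R \<beta> S v *\<^sub>v x = R v *\<^sub>v (inv_mat (C_mat K R \<beta> S) *\<^sub>v ((R v)\<^sup>T *\<^sub>v x))"
proof -
  note Ci = C_mat_inverse(1)[OF S]
  have RT: "(R v)\<^sup>T \<in> carrier_mat K r" using R[of v] by simp
  have "(R v)\<^sup>T *\<^sub>v x \<in> carrier_vec K" using RT x by simp
  then show ?thesis
    unfolding G_mat_def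
    using assoc_mult_mat_vec[OF mult_carrier_mat[OF R Ci] RT x] assoc_mult_mat_vec[OF R Ci] by simp
qed

text \<open>With \<open>z\<close> the image of \<open>(R v)\<^sup>T *\<^sub>v x\<close> under the
  inverse of \<open>C_mat\<close>, the form equals
  \<open>z \<bullet> (C_mat K R \<beta> S *\<^sub>v z)\<close>, and coercivity applies.\<close>

lemma G_mat_nonneg:
  assumes S: "S \<subseteq> set vs" and x: "x \<in> carrier_vec r"
  shows "0 \<le> x \<bullet> (G_mat K R \<beta> S v *\<^sub>v x)"
proof -
  define y where "y = (R v)\<^sup>T *\<^sub>v x"
  define z where "z = inv_mat (C_mat K R \<beta> S) *\<^sub>v y"
  have y: "y \<in> carrier_vec K" using R[of v] x by (auto simp: y_def)
  have z: "z \<in> carrier_vec K" using C_mat_inverse(1)[OF S] y by (auto simp: z_def)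
  have "0 \<le> \<beta> * (z \<bullet> z)" using \<beta> by (simp add: scalar_prod_self_nonneg)
  also have "\<dots> \<le> z \<bullet> (C_mat K R \<beta> S *\<^sub>v z)" by (rule C_mat_coercive[OF S z])
  also have "\<dots> = y \<bullet> z"
    using C_mat_mult_inverse[OF S y] comm_scalar_prod[OF z y] by (simp add: z_def)
  also have "\<dots> = x \<bullet> (R v *\<^sub>v z)"
    unfolding y_def by (rule transpose_vec_mult_scalar[OF R z x])
  finally show ?thesis
    by (simp add: G_mat_mult[OF S x] z_def y_def)
qed

text \<open>Semidefiniteness of \<open>G_mat\<close> makes the matrix coercive with constant 1.
  Later proofs use its inverse only through the equation for \<open>x\<close>.\<close>

lemma solve_I_plus_G:
  fixes v
  assumes S: "S \<subseteq> set vs" and q: "q \<in> carrier_vec r"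
  defines "x \<equiv> inv_mat (1\<^sub>m r + G_mat K R \<beta> S v) *\<^sub>v q"
  shows "x \<in> carrier_vec r" and "x + G_mat K R \<beta> S v *\<^sub>v x = q"
proof -
  let ?M = "1\<^sub>m r + G_mat K R \<beta> S v"
  note G = G_mat_carrier[OF S, of v]
  have M: "?M \<in> carrier_mat r r" using G by simp
  have mult: "?M *\<^sub>v y = y + G_mat K R \<beta> S v *\<^sub>v y" if "y \<in> carrier_vec r" for y
    using add_mult_distrib_mat_vec[OF one_carrier_mat G that] that by simp
  have "1 * (y \<bullet> y) \<le> y \<bullet> (?M *\<^sub>v y)" if y: "y \<in> carrier_vec r" for y
  proof -
    have "G_mat K R \<beta> S v *\<^sub>v y \<in> carrier_vec r" using G y by simp
    then show ?thesis
      using G_mat_nonneg[OF S y] by (simp add: mult[OF y] scalar_prod_add_distrib[OF y y])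
  qed
  then have "?M \<in> Units (ring_mat TYPE(real) r ())"
    by (intro coercive_imp_unit[OF M, where a = 1]) auto
  from inv_mat_unit[OF this M]
  have inv: "inv_mat ?M \<in> carrier_mat r r" "?M * inv_mat ?M = 1\<^sub>m r" by auto
  show x: "x \<in> carrier_vec r" using inv(1) q by (auto simp: x_def)
  have "?M *\<^sub>v x = q"
    unfolding x_def using assoc_mult_mat_vec[OF M inv(1) q] inv(2) q by simp
  then show "x + G_mat K R \<beta> S v *\<^sub>v x = q" by (simp add: mult[OF x])
qed

section \<open>The effect of adding one vertex\<close>

lemma q_vec_carrier:
  assumes "S \<subseteq> set vs" "g \<in> carrier_vec K"
  shows "q_vec K R \<beta> g S v \<in> carrier_vec r"
  using R[of v] h_vec_carrier[OF assms] by (auto simp: q_vec_def)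

text \<open>The update is checked by substitution. The equation for \<open>x\<close> reads
  \<open>R v *\<^sub>v h = x + R v *\<^sub>v z\<close>, so \<open>R v\<close> maps
  \<open>h - z\<close> to \<open>x\<close>; the enlarged matrix then maps \<open>h - z\<close> to
  \<open>(g - y) + y = g\<close>, and invertibility identifies it as the new
  \<open>h_vec\<close>.\<close>

lemma h_vec_insert:
  assumes S: "S \<subseteq> set vs" and v: "v \<in> set vs" "v \<notin> S" and g: "g \<in> carrier_vec K"
  defines "x \<equiv> inv_mat (1\<^sub>m r + G_mat K R \<beta> S v) *\<^sub>v q_vec K R \<beta> g S v"
  shows "h_vec K R \<beta> g (insert v S)
      = h_vec K R \<beta> g S - inv_mat (C_mat K R \<beta> S) *\<^sub>v ((R v)\<^sup>T *\<^sub>v x)"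
proof -
  define h where "h = h_vec K R \<beta> g S"
  define y where "y = (R v)\<^sup>T *\<^sub>v x"
  define z where "z = inv_mat (C_mat K R \<beta> S) *\<^sub>v y"
  have S': "insert v S \<subseteq> set vs" using S v by simp
  have fin: "finite S" using S finite_subset by blast
  have x: "x \<in> carrier_vec r" and xG: "x + G_mat K R \<beta> S v *\<^sub>v x = q_vec K R \<beta> g S v"
    using solve_I_plus_G[OF S q_vec_carrier[OF S g]] by (auto simp: x_def)
  have RT: "(R v)\<^sup>T \<in> carrier_mat K r" using R[of v] by simp
  have h: "h \<in> carrier_vec K" unfolding h_def by (rule h_vec_carrier[OF S g])
  have y: "y \<in> carrier_vec K" using RT x by (simp add: y_def)
  have z: "z \<in> carrier_vec K" using C_mat_inverse(1)[OF S] y by (auto simp: z_def)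
  have Ch: "C_mat K R \<beta> S *\<^sub>v h = g"
    unfolding h_def h_vec_def by (rule C_mat_mult_inverse[OF S g])
  have Cz: "C_mat K R \<beta> S *\<^sub>v z = y" unfolding z_def by (rule C_mat_mult_inverse[OF S y])
  have "R v *\<^sub>v h = x + R v *\<^sub>v z"
    using xG by (simp add: G_mat_mult[OF S x] z_def y_def q_vec_def h_def)
  then have "R v *\<^sub>v (h - z) = x"
    using x R[of v] by (simp add: mult_minus_distrib_mat_vec[OF R h z]) (intro eq_vecI, auto)
  moreover have "C_mat K R \<beta> S *\<^sub>v (h - z) = g - y"
    using mult_minus_distrib_mat_vec[OF C_mat_carrier h z] Ch Cz by simp
  ultimately have "C_mat K R \<beta> (insert v S) *\<^sub>v (h - z) = (g - y) + y"
    using C_mat_insert_mult[OF fin v(2), of "h - z"] h z by (simp add: y_def)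
  also have "\<dots> = g" using g y by (intro eq_vecI) auto
  finally have "h_vec K R \<beta> g (insert v S) = h - z"
    using C_mat_inverse_mult[OF S', of "h - z"] h z by (simp add: h_vec_def)
  then show ?thesis by (simp add: h_def z_def y_def)
qed

text \<open>By the closed form and the update, the risk drops by
  \<open>\<beta> * (g \<bullet> z)\<close>; what remains is to carry \<open>g \<bullet> z\<close>
  over to \<open>q \<bullet> x\<close>.\<close>

lemma target_risk_insert:
  assumes S: "S \<subseteq> set vs" and v: "v \<in> set vs" "v \<notin> S" and g: "g \<in> carrier_vec K"
  defines "q \<equiv> q_vec K R \<beta> g S v"
  shows "target_risk vs r K R \<beta> g S - target_risk vs r K R \<beta> g (insert v S)
      = \<beta> * (q \<bullet> (inv_mat (1\<^sub>m r + G_mat K R \<beta> S v) *\<^sub>v q))"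
proof -
  define x where "x = inv_mat (1\<^sub>m r + G_mat K R \<beta> S v) *\<^sub>v q"
  define h where "h = h_vec K R \<beta> g S"
  define y where "y = (R v)\<^sup>T *\<^sub>v x"
  define z where "z = inv_mat (C_mat K R \<beta> S) *\<^sub>v y"
  have S': "insert v S \<subseteq> set vs" using S v by simp
  have q: "q \<in> carrier_vec r" unfolding q_def by (rule q_vec_carrier[OF S g])
  have x: "x \<in> carrier_vec r" using solve_I_plus_G(1)[OF S q] by (simp add: x_def)
  have h: "h \<in> carrier_vec K" unfolding h_def by (rule h_vec_carrier[OF S g])
  have y: "y \<in> carrier_vec K" using R[of v] x by (auto simp: y_def)
  have z: "z \<in> carrier_vec K" using C_mat_inverse(1)[OF S] y by (auto simp: z_def)
  have Ch: "C_mat K R \<beta> S *\<^sub>v h = g"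
    unfolding h_def h_vec_def by (rule C_mat_mult_inverse[OF S g])
  have Cz: "C_mat K R \<beta> S *\<^sub>v z = y" unfolding z_def by (rule C_mat_mult_inverse[OF S y])
  have "g \<bullet> z = z \<bullet> g" by (rule comm_scalar_prod[OF g z])
  \<comment> \<open>Here \<open>g\<close> and \<open>y\<close> are the images of \<open>h\<close>
    and \<open>z\<close> under \<open>C_mat\<close>, so symmetry swaps the roles of \<open>h\<close>
    and \<open>z\<close>.\<close>
  also have "\<dots> = h \<bullet> y" using C_mat_symmetric[OF S z h] Ch Cz by simp
  also have "\<dots> = y \<bullet> h" by (rule comm_scalar_prod[OF h y])
  also have "\<dots> = x \<bullet> q"
    unfolding y_def q_def q_vec_def h_def[symmetric] by (rule transpose_vec_mult_scalar[OF R h x])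
  also have "\<dots> = q \<bullet> x" by (rule comm_scalar_prod[OF x q])
  finally have gz: "g \<bullet> z = q \<bullet> x" .
  have "h_vec K R \<beta> g (insert v S) = h - z"
    using h_vec_insert[OF S v g] by (simp add: x_def y_def z_def h_def q_def)
  then show ?thesis
    using gz
    by (simp add: target_risk_eq[OF S g] target_risk_eq[OF S' g] scalar_prod_minus_distrib[OF g h z]
        algebra_simps flip: h_def x_def)
qed

text \<open>Split \<open>q = x + y\<close> with \<open>y\<close> the image of \<open>x\<close> under
  \<open>G_mat\<close>. Then \<open>q \<bullet> x\<close> is
  \<open>x \<bullet> x + x \<bullet> y\<close>, the gap to \<open>q \<bullet> q\<close> is
  \<open>x \<bullet> y + y \<bullet> y\<close>, and \<open>x \<bullet> y\<close> is nonnegative by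
  semidefiniteness.\<close>

lemma I_plus_G_inverse_bounds:
  fixes v
  assumes S: "S \<subseteq> set vs" and q: "q \<in> carrier_vec r"
  defines "x \<equiv> inv_mat (1\<^sub>m r + G_mat K R \<beta> S v) *\<^sub>v q"
  shows "0 \<le> q \<bullet> x" and "q \<bullet> x \<le> q \<bullet> q"
proof -
  define y where "y = G_mat K R \<beta> S v *\<^sub>v x"
  have x: "x \<in> carrier_vec r" and q_eq: "q = x + y"
    using solve_I_plus_G[OF S q, of v] by (auto simp: x_def y_def)
  have y: "y \<in> carrier_vec r" using G_mat_carrier[OF S, of v] x by (simp add: y_def)
  have nonneg: "0 \<le> x \<bullet> y" unfolding y_def by (rule G_mat_nonneg[OF S x])
  have qx: "q \<bullet> x = x \<bullet> x + x \<bullet> y"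
    using comm_scalar_prod[OF x y] by (simp add: q_eq add_scalar_prod_distrib[OF x y x])
  have qy: "q \<bullet> y = x \<bullet> y + y \<bullet> y"
    by (simp add: q_eq add_scalar_prod_distrib[OF x y y])
  have qq: "q \<bullet> q = q \<bullet> x + q \<bullet> y"
    using scalar_prod_add_distrib[OF q x y] q_eq by simp
  show "0 \<le> q \<bullet> x"
    using nonneg scalar_prod_self_nonneg[of x] by (simp add: qx)
  show "q \<bullet> x \<le> q \<bullet> q"
    using nonneg scalar_prod_self_nonneg[of y] by (simp add: qq qy)
qed

end

section \<open>Normalization and the factorization of the risk reduction\<close>

theorem proposition2p6:
  fixes V :: "'a set" and E :: "'a set set" and \<omega> :: "'a set \<Rightarrow> real"
    and vs :: "'a list" and n K r :: nat
    and U :: "real mat" and lam :: "nat \<Rightarrow> real"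
    and \<tau> \<beta> :: real and ts :: "real list" and c g :: "real vec"
    and R :: "'a \<Rightarrow> real mat" and S :: "'a set" and v :: 'a
  assumes graph: "weighted_graph V E \<omega>" and conn: "connected_on V E"
    and enum: "distinct vs" "set vs = V" and n: "n = card V"
    and U: "U \<in> carrier_mat n n" "U\<^sup>T * U = 1\<^sub>m n" "U * U\<^sup>T = 1\<^sub>m n"
    and eigendecomposition: "laplacian_mat vs E \<omega> = U * mat_diag n lam * U\<^sup>T"
    and eigenvalues: "lam 0 = 0" "1 < n \<Longrightarrow> 0 < lam 1"
      "\<And>i j. i \<le> j \<Longrightarrow> j < n \<Longrightarrow> lam i \<le> lam j"
    and K: "1 \<le> K" "K \<le> n"
    and \<tau>: "0 < \<tau>"
    and times: "r = length ts" "1 \<le> r" "sorted_wrt (<) ts" "\<And>t. t \<in> set ts \<Longrightarrow> 0 \<le> t \<and> t < \<tau>"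
    and c: "c \<in> carrier_vec n" "\<And>i. i < n \<Longrightarrow> 0 \<le> c $ i" "(\<Sum>i<n. c $ i) = 1"
    and \<beta>: "0 < \<beta>"
    and R: "R = measurement_block vs U lam ts K"
    and g: "g = target_direction U lam K \<tau> c"
    and S: "S \<subseteq> V" and v: "v \<in> V - S"
  shows "(normalized_target_risk vs r K R \<beta> g S)\<^sup>2
           - (normalized_target_risk vs r K R \<beta> g (S \<union> {v}))\<^sup>2
         = A_factor K R \<beta> g S v * eta_factor r K R \<beta> g S v
       \<and> 0 \<le> eta_factor r K R \<beta> g S v \<and> eta_factor r K R \<beta> g S v \<le> 1"
proof -
  have Rc: "R u \<in> carrier_mat r K" for u
    by (simp add: R measurement_block_def times(1))
  have gc: "g \<in> carrier_vec K"
    by (intro carrier_vecI) (simp add: g target_direction_def mat_diag_def)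
  have Ss: "S \<subseteq> set vs" and vS: "v \<in> set vs" "v \<notin> S"
    using S v enum by auto
  then have S': "insert v S \<subseteq> set vs" by simp
  \<comment> \<open>These facts discharge, in this order, the context assumptions that became
    premises of the exported lemmas.\<close>
  note ctx = enum(1) Rc \<beta>
  define q where "q = q_vec K R \<beta> g S v"
  define x where "x = inv_mat (1\<^sub>m r + G_mat K R \<beta> S v) *\<^sub>v q"
  have q: "q \<in> carrier_vec r"
    unfolding q_def by (rule q_vec_carrier[OF ctx Ss gc])
  have eta: "eta_factor r K R \<beta> g S v = (if q = 0\<^sub>v r then 0 else (q \<bullet> x) / (q \<bullet> q))"
    by (simp add: eta_factor_def Let_def l2norm_square q_def x_def)
  have bounds: "0 \<le> q \<bullet> x" "q \<bullet> x \<le> q \<bullet> q"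
    unfolding x_def by (rule I_plus_G_inverse_bounds[OF ctx Ss q])+
  \<comment> \<open>For \<open>q = 0\<^sub>v r\<close> both sides vanish, so the default value 0 of
    \<open>eta_factor\<close> fits; otherwise the positive \<open>q \<bullet> q\<close>
    cancels.\<close>
  have "(q \<bullet> q) * eta_factor r K R \<beta> g S v = q \<bullet> x"
    using bounds scalar_prod_self_pos[OF q] by (auto simp: eta)
  then have "A_factor K R \<beta> g S v * eta_factor r K R \<beta> g S v = \<beta> * (q \<bullet> x) / (l2norm g)\<^sup>2"
    by (simp add: A_factor_def l2norm_square flip: q_def)
  \<comment> \<open>Both sides carry the same divisor \<open>(l2norm g)\<^sup>2\<close>, so nothing
    has to be cancelled.\<close>
  also have "\<dots> = (normalized_target_risk vs r K R \<beta> g S)\<^sup>2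
      - (normalized_target_risk vs r K R \<beta> g (S \<union> {v}))\<^sup>2"
    using target_risk_insert[OF ctx Ss vS gc]
    by (simp add: normalized_target_risk_square[OF ctx Ss gc]
        normalized_target_risk_square[OF ctx S' gc] q_def x_def flip: diff_divide_distrib)
  finally show ?thesis
    using bounds scalar_prod_self_pos[OF q] by (auto simp: eta divide_le_eq)
qed

end
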